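(* Let $0<q\le 1$ and $0<s<1$. Then $$\left(\frac{1-q^{x+s/2}}{1-q}\right)^{1-s}<\frac{\Gamma_q(x+1)}{\Gamma_q(x+s)}<\exp\left[(1-s)\,\psi_q\!\left(x+\frac{s+1}{2}\right)\right],$$ where the left-hand inequality holds for all real $x>-s/2$ and the right-hand inequality holds for all real $x>-s$. (For $q=1$, the quantity $\frac{1-q^{x+s/2}}{1-q}$ is understood as its limit $x+s/2$ as $q\to1^-$.)
   Context: For $0<q<1$ the $q$-gamma function is $\Gamma_q(x)=(1-q)^{1-x}\prod_{n=0}^\infty \frac{1-q^{n+1}}{1-q^{n+x}}$; for $q=1$, $\Gamma_1=\Gamma$ is the ordinary gamma function. In both cases $\psi_q(x)=\Gamma_q'(x)/\Gamma_q(x)$ denotes the logarithmic derivative. *)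

theory Defs
  imports "HOL-Analysis.Analysis"
begin

text \<open>
  The \<open>q\<close>-gamma function for \<open>0 < q \<le> 1\<close>. Real powers of \<open>q\<close> are written
  with \<open>powr\<close>, which is the usual power because \<open>q > 0\<close>. At the poles
  \<open>0, -1, -2, \<dots>\<close> division by zero makes the value \<open>0\<close>, as for the library's \<open>Gamma\<close>.
\<close>
definition q_Gamma :: "real \<Rightarrow> real \<Rightarrow> real" where
  "q_Gamma q x =
     (if q = 1 then Gamma x
      else (1 - q) powr (1 - x) *
           (\<Prod>n. (1 - q ^ (n + 1)) / (1 - q powr (real n + x))))"

definition q_psi :: "real \<Rightarrow> real \<Rightarrow> real" where
  "q_psi q x = deriv (q_Gamma q) x / q_Gamma q x"

text \<open>
  At \<open>q = 1\<close> the \<open>q\<close>-number \<open>(1 - q\<^sup>y) / (1 - q)\<close> is understood as its limit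
  for \<open>q\<close> tending to \<open>1\<close> from the left; see \<open>q_number_tendsto\<close> below.
\<close>
definition q_number :: "real \<Rightarrow> real \<Rightarrow> real" where
  "q_number q y = (if q = 1 then y else (1 - q powr y) / (1 - q))"

lemma q_number_tendsto: "((\<lambda>q. (1 - q powr y) / (1 - q)) \<longlongrightarrow> q_number 1 y) (at_left 1)"
proof -
  have "((\<lambda>q. q powr y) has_field_derivative y) (at_left (1::real))"
    by (rule DERIV_subset[of _ _ _ UNIV]) (auto intro!: derivative_eq_intros)
  then have "((\<lambda>q. (q powr y - 1) / (q - 1)) \<longlongrightarrow> y) (at_left (1::real))"
    by (simp add: has_field_derivative_iff)
  moreover have "(q powr y - 1) / (q - 1) = (1 - q powr y) / (1 - q)" for q :: real
    by (metis minus_diff_eq minus_divide_divide)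
  ultimately show ?thesis
    by (simp add: q_number_def)
qed

end

theory Submission imports Defs begin

text \<open>
  Let \<open>G\<close> be the logarithm of the \<open>q\<close>-number, \<open>g\<close> its derivative, \<open>m = x + (s + 1) / 2\<close> and
  \<open>\<phi>\<^sub>k t = G (k + m + t) - G (k + m - t)\<close>. Gauss's product gives
  \<open>ln (\<Gamma>\<^sub>q (x + 1) / \<Gamma>\<^sub>q (x + s))\<close> as the limit of \<open>(1 - s) G N - (\<Sum>k<N. \<phi>\<^sub>k ((1 - s) / 2))\<close>, and
  \<open>\<psi>\<^sub>q m\<close> as the limit of \<open>G N - (\<Sum>k<N. g (k + m))\<close>. As \<open>g\<close> is strictly convex, each \<open>\<phi>\<^sub>k\<close> has a
  strictly increasing derivative; hence \<open>\<phi>\<^sub>k ((1 - s) / 2) > (1 - s) g (k + m)\<close>, which summed over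
  \<open>k\<close> is the upper bound, and \<open>\<phi>\<^sub>k ((1 - s) / 2) < (1 - s) \<phi>\<^sub>k (1 / 2)\<close>, where the right-hand side
  telescopes to the lower bound.
\<close>

section \<open>The logarithm of the q-number: strict convexity of its derivative, and chord
  estimates\<close>

definition q_slope :: "real \<Rightarrow> real \<Rightarrow> real" where
  "q_slope q u = (if q = 1 then 1 / u else - ln q * (q powr u / (1 - q powr u)))"

lemma powr_lt_1:
  fixes q u :: real
  assumes "0 < q" "q < 1" "0 < u"
  shows "q powr u < 1"
  using powr_less_mono'[of q 0 u] assms by simp

lemma q_number_pos:
  assumes "0 < q" "q \<le> 1" "0 < u"
  shows "0 < q_number q u"
  using assms powr_lt_1[of q u] by (auto simp: q_number_def)

lemma ln_q_number_deriv:
  assumes "0 < q" "q \<le> 1" "0 < u"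
  shows "((\<lambda>u. ln (q_number q u)) has_field_derivative q_slope q u) (at u)"
proof (cases "q = 1")
  case True
  then show ?thesis using assms
    by (auto simp: q_number_def q_slope_def intro!: derivative_eq_intros)
next
  case False
  then have "q powr u < 1" using assms by (intro powr_lt_1) auto
  then show ?thesis using assms False
    unfolding q_number_def q_slope_def
    by (auto intro!: derivative_eq_intros simp: divide_simps)
qed

text \<open>The difference of the two sides factors as
  \<open>(y - x) * (1 - x * y) / (x * y)\<close>, and \<open>x * y < 1\<close>. With
  \<open>x = q powr T\<close> and \<open>y = q powr t\<close> it shows that q^r + q^(-r) strictly
  increases for r \<ge> 0.\<close>

lemma add_inverse_strict_antimono:
  fixes x y :: real
  assumes "0 < x" "x < y" "y \<le> 1"
  shows "y + 1 / y < x + 1 / x"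
proof -
  have "0 < (y - x) * (1 - x * y) / (x * y)"
    using assms mult_strict_mono[of x 1 y 1] by (cases "y = 1") auto
  also have "\<dots> = x + 1 / x - (y + 1 / y)"
    using assms by (simp add: field_simps)
  finally show ?thesis by simp
qed

text \<open>Closed forms replace second derivatives. For q = 1 the symmetric sum at distance r is
  \<open>2 * m / (m * m - r * r)\<close>. For q < 1 it is, up to the factor \<open>- ln q\<close>, a
  function of \<open>C r\<close> = q^r + q^(-r) alone, increasing because
  \<open>p * p < 1\<close>.\<close>

lemma q_slope_strict_convex:
  assumes "0 < q" "q \<le> 1" "0 \<le> t" "t < T" "T < m"
  shows "q_slope q (m + t) + q_slope q (m - t) < q_slope q (m + T) + q_slope q (m - T)"
proof (cases "q = 1")
  case True
  have *: "1 / (m + r) + 1 / (m - r) = 2 * m / (m * m - r * r)" if "0 \<le> r" "r < m" for r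
    using that by (simp add: field_simps)
  have "t * t < T * T" "T * T < m * m"
    using assms by (auto intro!: mult_strict_mono')
  then have "2 * m / (m * m - t * t) < 2 * m / (m * m - T * T)"
    using assms by (intro divide_strict_left_mono) auto
  then show ?thesis
    using *[of t] *[of T] assms True by (simp add: q_slope_def)
next
  case False
  then have q: "0 < q" "q < 1" using assms by auto
  define p where "p = q powr m"
  define C where "C r = q powr r + 1 / q powr r" for r
  have p: "0 < p" "p < 1" using q assms powr_lt_1[of q m] by (auto simp: p_def)
  have *: "q powr (m + r) / (1 - q powr (m + r)) + q powr (m - r) / (1 - q powr (m - r))
             = (1 - p * p) / (1 - p * C r + p * p) - 1"
    and **: "0 < 1 - p * C r + p * p" if r: "0 \<le> r" "r < m" for r
  proof -
    define B where "B = q powr r"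
    have B: "0 < B" using q by (simp add: B_def)
    have e: "q powr (m + r) = p * B" "q powr (m - r) = p / B"
      by (simp_all add: p_def B_def powr_add powr_diff)
    have l: "p * B < 1" "p / B < 1"
      using powr_lt_1[OF q, of "m + r"] powr_lt_1[OF q, of "m - r"] r e by auto
    have f: "1 - p * C r + p * p = (1 - p * B) * (1 - p / B)"
      using B by (simp add: C_def B_def[symmetric] field_simps)
    show "0 < 1 - p * C r + p * p" unfolding f using l by simp
    \<comment> \<open>Here x = q^(m + r) and y = q^(m - r), so \<open>x * y = p * p\<close> is
      independent of r and only the denominator varies.\<close>
    have "x / (1 - x) + y / (1 - y) = (1 - x * y) / ((1 - x) * (1 - y)) - 1"
      if "x < 1" "y < 1" for x y :: real
      using that by (simp add: divide_simps) (simp add: algebra_simps)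
    from this[OF l] show "q powr (m + r) / (1 - q powr (m + r)) + q powr (m - r) / (1 - q powr (m - r))
             = (1 - p * p) / (1 - p * C r + p * p) - 1"
      unfolding f e using B by simp
  qed
  have "q powr T < q powr t" "q powr t \<le> 1"
    using assms q by (auto intro!: powr_less_mono' powr_le1)
  then have "C t < C T"
    unfolding C_def using q by (intro add_inverse_strict_antimono) auto
  then have "1 - p * C T + p * p < 1 - p * C t + p * p" using p by simp
  moreover have "p * p < 1" using p mult_strict_mono[of p 1 p 1] by simp
  ultimately have "(1 - p * p) / (1 - p * C t + p * p) - 1 < (1 - p * p) / (1 - p * C T + p * p) - 1"
    using **[of t] **[of T] assms
    by (intro diff_strict_right_mono divide_strict_left_mono) auto
  then have "(- ln q) * ((1 - p * p) / (1 - p * C t + p * p) - 1)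
      < (- ln q) * ((1 - p * p) / (1 - p * C T + p * p) - 1)"
    using q by (intro mult_strict_left_mono) auto
  then show ?thesis
    using *[of t] *[of T] assms False
    by (simp only: q_slope_def if_False distrib_left[symmetric])
qed

text \<open>By the mean value theorem \<open>f t / t\<close> is a value of \<open>f'\<close>
  strictly between 0 and t, while the slope of \<open>f\<close> from t to T is a value of
  \<open>f'\<close> beyond t. Monotonicity of \<open>f'\<close> orders these slopes.\<close>

lemma strict_mono_deriv_chord:
  fixes f f' :: "real \<Rightarrow> real"
  assumes deriv: "\<And>r. 0 \<le> r \<Longrightarrow> r < b \<Longrightarrow> (f has_field_derivative f' r) (at r)"
    and mono: "\<And>r u. 0 \<le> r \<Longrightarrow> r < u \<Longrightarrow> u < b \<Longrightarrow> f' r < f' u"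
    and f0: "f 0 = 0" and t: "0 < t" "t < b"
  shows "t * f' 0 < f t"
    and "\<And>T. t < T \<Longrightarrow> T < b \<Longrightarrow> f t < t / T * f T"
proof -
  obtain r where r: "0 < r" "r < t" "f t - f 0 = (t - 0) * f' r"
    using MVT2[of 0 t f f'] deriv t by auto
  then show "t * f' 0 < f t" using mono[of 0 r] t f0 by simp
  show "f t < t / T * f T" if T: "t < T" "T < b" for T
  proof -
    obtain u where u: "t < u" "u < T" "f T - f t = (T - t) * f' u"
      using MVT2[of t T f f'] deriv t T by auto
    have "f' r < f' u" using mono[of r u] r u T by simp
    then have "t * (T - t) * f' r < t * (T - t) * f' u"
      using t T by (intro mult_strict_left_mono) auto
    then have "(T - t) * f t < t * (f T - f t)"
      using r u f0 by (simp add: mult_ac)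
    then have "T * f t < t * f T" by (simp add: algebra_simps)
    then show ?thesis using t T by (simp add: field_simps)
  qed
qed

text \<open>The difference is odd in t, and its derivative is the symmetric sum of slopes, equal to
  \<open>2 * q_slope q m\<close> at t = 0. The tangent estimate serves the upper bound of the
  theorem, the chord estimate the lower one.\<close>

lemma ln_q_number_chord:
  assumes q: "0 < q" "q \<le> 1" and t: "0 < t" "t < m"
  shows "2 * t * q_slope q m < ln (q_number q (m + t)) - ln (q_number q (m - t))"
    and "\<And>T. t < T \<Longrightarrow> T < m \<Longrightarrow> ln (q_number q (m + t)) - ln (q_number q (m - t))
            < t / T * (ln (q_number q (m + T)) - ln (q_number q (m - T)))"
proof -
  define f where "f r = ln (q_number q (m + r)) - ln (q_number q (m - r))" for r
  define f' where "f' r = q_slope q (m + r) + q_slope q (m - r)" for r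
  have deriv: "(f has_field_derivative f' r) (at r)" if "0 \<le> r" "r < m" for r
  proof -
    have "((\<lambda>r. ln (q_number q (m + r))) has_field_derivative q_slope q (m + r) * 1) (at r)"
         "((\<lambda>r. ln (q_number q (m - r))) has_field_derivative q_slope q (m - r) * (-1)) (at r)"
      by (rule DERIV_chain2[OF ln_q_number_deriv[OF q]]; use that in \<open>auto intro!: derivative_eq_intros\<close>)+
    from DERIV_diff[OF this] show ?thesis by (simp add: f_def[abs_def] f'_def)
  qed
  have mono: "f' r < f' u" if "0 \<le> r" "r < u" "u < m" for r u
    unfolding f'_def using that by (intro q_slope_strict_convex q)
  have f0: "f 0 = 0" by (simp add: f_def)
  show "2 * t * q_slope q m < ln (q_number q (m + t)) - ln (q_number q (m - t))"
    using strict_mono_deriv_chord(1)[of m f f' t, OF deriv mono f0 t]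
    by (simp add: f_def f'_def)
  show "ln (q_number q (m + t)) - ln (q_number q (m - t))
            < t / T * (ln (q_number q (m + T)) - ln (q_number q (m - T)))"
    if "t < T" "T < m" for T
    using strict_mono_deriv_chord(2)[of m f f' t, OF deriv mono f0 t that]
    by (simp add: f_def)
qed

section \<open>Limits of powers of q and of logarithms of q-numbers\<close>

lemma powr_of_nat_add:
  fixes q z :: real
  assumes "0 < q"
  shows "q powr (real n + z) = q ^ n * q powr z"
  using assms by (simp add: powr_add powr_realpow)

lemma q_power_Suc_lt_1:
  fixes q :: real
  assumes "0 < q" "q < 1"
  shows "q ^ (n + 1) < 1"
  using power_Suc_less_one[of q n] assms by simp

lemma q_powr_tendsto_0:
  fixes q c :: real
  assumes "0 < q" "q < 1"
  shows "(\<lambda>N. q powr (real N + c)) \<longlonglongrightarrow> 0"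
proof -
  have "(\<lambda>N. q ^ N * q powr c) \<longlonglongrightarrow> 0 * q powr c"
    using assms by (intro tendsto_intros LIMSEQ_realpow_zero) auto
  then show ?thesis using assms by (simp add: powr_of_nat_add)
qed

lemma ln_q_number_tendsto:
  assumes "0 < q" "q < 1"
  shows "(\<lambda>N. ln (q_number q (real N + c))) \<longlonglongrightarrow> - ln (1 - q)"
proof -
  have "(\<lambda>N. ln ((1 - q powr (real N + c)) / (1 - q))) \<longlonglongrightarrow> ln ((1 - 0) / (1 - q))"
    using assms by (intro tendsto_intros q_powr_tendsto_0) auto
  then show ?thesis using assms by (simp add: q_number_def ln_div)
qed

text \<open>Removes the far end of the telescoping sum. For q < 1 both logarithms tend to
  \<open>- ln (1 - q)\<close>; for q = 1 they diverge, so they are first combined into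
  \<open>ln (1 + c / real N)\<close>.\<close>

lemma ln_q_number_shift_tendsto:
  assumes "0 < q" "q \<le> 1"
  shows "(\<lambda>N. ln (q_number q (real N + c)) - ln (q_number q (real N))) \<longlonglongrightarrow> 0"
proof (cases "q = 1")
  case True
  have "(\<lambda>N. ln (1 + c / real N)) \<longlonglongrightarrow> ln (1 + 0)"
    by (intro tendsto_intros lim_const_over_n) auto
  moreover have "eventually (\<lambda>N. ln (1 + c / real N) = ln (real N + c) - ln (real N)) sequentially"
    using eventually_gt_at_top[of "nat \<lceil>\<bar>c\<bar>\<rceil>"]
  proof eventually_elim
    case (elim N)
    then have N: "\<bar>c\<bar> < real N" by linarith
    then have "1 + c / real N = (real N + c) / real N" by (simp add: field_simps)
    moreover have "0 < real N + c" "0 < real N" using N by linarith+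
    ultimately show ?case by (simp add: ln_div)
  qed
  ultimately show ?thesis
    using True by (simp add: q_number_def tendsto_cong)
next
  case False
  then show ?thesis
    using tendsto_diff[OF ln_q_number_tendsto[of q c] ln_q_number_tendsto[of q 0]] assms by simp
qed

section \<open>Series and limit formulas for the q-gamma function and its logarithmic
  derivative\<close>

lemma q_Gamma_series:
  assumes q: "0 < q" "q < 1" and z: "0 < z"
  shows "summable (\<lambda>n. ln (1 - q ^ (n + 1)) - ln (1 - q powr (real n + z)))" (is ?sum)
    and "((\<lambda>z. \<Sum>n. ln (1 - q ^ (n + 1)) - ln (1 - q powr (real n + z))) has_field_derivative
            (\<Sum>n. - q_slope q (real n + z))) (at z)" (is ?deriv)
    and "summable (\<lambda>n. q_slope q (real n + z))"
proof -
  define f where "f n z = ln (1 - q ^ (n + 1)) - ln (1 - q powr (real n + z))" for n :: nat and z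
  \<comment> \<open>On y > \<delta> the derivatives of the terms are dominated by the geometric
    series \<open>M\<close>: the numerator is at most q^n and the denominator at least
    \<open>1 - q powr \<delta>\<close>. The bound \<delta> < z puts z in this region, and \<delta> <
    1 does so for the reference point 1.\<close>
  define \<delta> where "\<delta> = min (z / 2) (1 / 2)"
  have \<delta>: "0 < \<delta>" "\<delta> < z" "\<delta> < 1" using z by (auto simp: \<delta>_def)
  define M where "M n = - ln q * (1 / (1 - q powr \<delta>)) * q ^ n" for n :: nat
  have lnq: "0 < - ln q" using q by simp
  have bound: "norm (- q_slope q (real n + y)) \<le> M n" if "y \<in> {\<delta><..}" for n y
  proof -
    have y: "\<delta> < y" using that by simp
    have d: "q powr (real n + y) \<le> q powr \<delta>" "q powr \<delta> < 1" "q powr (real n + y) \<le> q ^ n"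
      using q y \<delta> powr_mono'[of "real n" "real n + y" q]
      by (auto intro!: powr_mono' powr_lt_1 simp: powr_realpow)
    have "q powr (real n + y) / (1 - q powr (real n + y)) \<le> q ^ n / (1 - q powr \<delta>)"
      using d q by (intro frac_le) auto
    then have "- ln q * (q powr (real n + y) / (1 - q powr (real n + y))) \<le> M n"
      using mult_left_mono[OF _ less_imp_le[OF lnq]] unfolding M_def by fastforce
    moreover have "0 \<le> - ln q * (q powr (real n + y) / (1 - q powr (real n + y)))"
      using lnq d by (intro mult_nonneg_nonneg divide_nonneg_nonneg) auto
    moreover have "q \<noteq> 1" using q by simp
    ultimately show ?thesis
      by (simp only: q_slope_def if_False norm_minus_cancel real_norm_def abs_of_nonneg)
  qed
  have sM: "summable M" unfolding M_def using q by (intro summable_mult summable_geometric) auto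
  have uc: "uniformly_convergent_on {\<delta><..} (\<lambda>n y. \<Sum>i<n. - q_slope q (real i + y))"
    by (rule Weierstrass_m_test'[OF bound sM])
  have deriv: "(f n has_field_derivative - q_slope q (real n + y)) (at y within {\<delta><..})"
    if "y \<in> {\<delta><..}" for n y
  proof -
    have "q powr (real n + y) < 1" using q that \<delta> by (intro powr_lt_1) auto
    then have "(f n has_field_derivative - q_slope q (real n + y)) (at y)"
      unfolding f_def q_slope_def using q by (auto intro!: derivative_eq_intros)
    then show ?thesis by (rule has_field_derivative_at_within)
  qed
  \<comment> \<open>Termwise differentiation needs convergence at one point; at 1 every term
    vanishes.\<close>
  have one: "summable (\<lambda>n. f n 1)"
    using q by (simp add: f_def powr_add powr_realpow mult.commute)
  have zi: "z \<in> interior {\<delta><..}" using \<delta> by (simp add: interior_open)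
  have "convex {\<delta><..}" by simp
  note * = has_field_derivative_series'[where f = f and f' = "\<lambda>n y. - q_slope q (real n + y)"
      and S = "{\<delta><..}" and ?x0.0 = 1 and x = z, OF this deriv uc _ one zi]
  show ?sum using *(1) \<delta> by (simp add: f_def)
  show ?deriv using *(2) \<delta> by (simp add: f_def)
  show "summable (\<lambda>n. q_slope q (real n + z))"
    by (rule summable_comparison_test'[OF sM, of 0]) (use bound[of z] \<delta> in auto)
qed

lemma q_Gamma_eq_exp:
  assumes q: "0 < q" "q < 1" and z: "0 < z"
  shows "q_Gamma q z = exp ((1 - z) * ln (1 - q)
           + (\<Sum>n. ln (1 - q ^ (n + 1)) - ln (1 - q powr (real n + z))))"
proof -
  have "(1 - q ^ (n + 1)) / (1 - q powr (real n + z))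
      = exp (ln (1 - q ^ (n + 1)) - ln (1 - q powr (real n + z)))" for n
    using q_power_Suc_lt_1[OF q, of n] powr_lt_1[OF q, of "real n + z"] z
    by (simp add: exp_diff)
  then have "(\<Prod>n. (1 - q ^ (n + 1)) / (1 - q powr (real n + z)))
      = exp (\<Sum>n. ln (1 - q ^ (n + 1)) - ln (1 - q powr (real n + z)))"
    using prodinf_exp[OF q_Gamma_series(1)[OF q z]] by simp
  then show ?thesis
    using q by (simp add: q_Gamma_def exp_add powr_def)
qed

lemma q_Gamma_pos:
  assumes "0 < q" "q \<le> 1" "0 < z"
  shows "0 < q_Gamma q z"
  using assms q_Gamma_eq_exp[of q z] by (cases "q = 1") (auto simp: q_Gamma_def Gamma_real_pos)

lemma q_psi_eq_suminf:
  assumes q: "0 < q" "q < 1" and z: "0 < z"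
  shows "q_psi q z = - ln (1 - q) - (\<Sum>n. q_slope q (real n + z))"
proof -
  let ?L = "\<lambda>z. (1 - z) * ln (1 - q) + (\<Sum>n. ln (1 - q ^ (n + 1)) - ln (1 - q powr (real n + z)))"
  let ?D = "- ln (1 - q) - (\<Sum>n. q_slope q (real n + z))"
  have "((\<lambda>z. exp (?L z)) has_field_derivative exp (?L z) * ?D) (at z)"
    unfolding diff_conv_add_uminus[of _ "suminf _"] suminf_minus[OF q_Gamma_series(3)[OF q z], symmetric]
    by (rule derivative_eq_intros q_Gamma_series(2)[OF q z] refl)+ simp
  \<comment> \<open>The exponential form is known only for positive arguments, so the derivative is
    transferred on a neighbourhood of z.\<close>
  moreover have "eventually (\<lambda>y. q_Gamma q y = exp (?L y)) (nhds z)"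
    using eventually_nhds_in_open[of "{0<..}" z] z
    by (auto elim!: eventually_mono simp: q_Gamma_eq_exp[OF q])
  ultimately have "(q_Gamma q has_field_derivative exp (?L z) * ?D) (at z)"
    by (subst DERIV_cong_ev[OF refl _ refl])
  then show ?thesis
    by (simp add: q_psi_def DERIV_imp_deriv q_Gamma_eq_exp[OF q z])
qed

text \<open>A common form for both cases: for q = 1 it is the classical limit for
  \<open>Digamma\<close>, for q < 1 the first term tends to \<open>- ln (1 - q)\<close> and the sum
  converges by itself.\<close>

lemma q_psi_LIMSEQ:
  assumes "0 < q" "q \<le> 1" and z: "0 < z"
  shows "(\<lambda>N. ln (q_number q (real N)) - (\<Sum>k<N. q_slope q (real k + z))) \<longlonglongrightarrow> q_psi q z"
proof (cases "q = 1")
  case True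
  have "z \<notin> \<int>\<^sub>\<le>\<^sub>0" using z by (auto elim!: nonpos_Ints_cases)
  then have "deriv Gamma z = Gamma z * Digamma z"
    by (intro DERIV_imp_deriv has_field_derivative_Gamma)
  moreover have "q_Gamma 1 = Gamma" by (auto simp: q_Gamma_def)
  moreover have "Gamma z > 0" using z by (rule Gamma_real_pos)
  ultimately have "q_psi q z = Digamma z" using True by (simp add: q_psi_def)
  then show ?thesis
    using Digamma_LIMSEQ[of z] z True
    by (simp add: q_number_def q_slope_def inverse_eq_divide add.commute)
next
  case False
  then have q: "0 < q" "q < 1" using assms by auto
  show ?thesis unfolding q_psi_eq_suminf[OF q z]
    using ln_q_number_tendsto[OF q, of 0]
    by (intro tendsto_diff summable_LIMSEQ q_Gamma_series(3)[OF q z]) auto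
qed

text \<open>In the ratio the factors independent of the argument cancel: the factorials of Gauss's
  product for q = 1, the factors 1 - q^(n+1) for q < 1. In the latter case the powers of
  \<open>1 - q\<close> supply the coefficient \<open>b - a\<close>.\<close>

lemma q_Gamma_ratio_LIMSEQ:
  assumes "0 < q" "q \<le> 1" and a: "0 < a" and b: "0 < b"
  shows "(\<lambda>N. (b - a) * ln (q_number q (real N))
            + (\<Sum>k<N. ln (q_number q (real k + a)) - ln (q_number q (real k + b))))
          \<longlonglongrightarrow> ln (q_Gamma q b / q_Gamma q a)"
proof (cases "q = 1")
  case True
  have pos: "0 < Gamma a" "0 < Gamma b" using a b by (auto intro: Gamma_real_pos)
  \<comment> \<open>The primed variant of the Gauss product has N factors in its denominator, not N
    + 1, which matches the range k < N.\<close>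
  have ln_series: "ln (Gamma_series' z N)
      = ln (fact (N - 1)) + z * ln (real N) - (\<Sum>k<N. ln (real k + z))" if z: "0 < z" for z N
  proof -
    have "ln (pochhammer z N) = (\<Sum>k<N. ln (real k + z))"
      using z by (simp add: pochhammer_prod ln_prod add.commute atLeast0LessThan)
    moreover have "0 < pochhammer z N" using z by (rule pochhammer_pos)
    ultimately show ?thesis by (simp add: Gamma_series'_def ln_div ln_mult)
  qed
  have "(\<lambda>N. ln (Gamma_series' b N) - ln (Gamma_series' a N)) \<longlonglongrightarrow> ln (Gamma b) - ln (Gamma a)"
    using pos by (intro tendsto_intros Gamma_series'_LIMSEQ) auto
  moreover have "Gamma a \<noteq> 0" "Gamma b \<noteq> 0" using pos by auto
  ultimately show ?thesis
    using True a b
    by (simp add: ln_series q_number_def q_Gamma_def ln_div sum_subtractf algebra_simps)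
next
  case False
  then have q: "0 < q" "q < 1" using assms by auto
  let ?S = "\<lambda>z n. ln (1 - q ^ (n + 1)) - ln (1 - q powr (real n + z))"
  have term_eq: "ln (q_number q (real k + a)) - ln (q_number q (real k + b)) = ?S b k - ?S a k" for k
    using powr_lt_1[OF q, of "real k + a"] powr_lt_1[OF q, of "real k + b"] a b q
    by (simp add: q_number_def ln_div)
  have "(\<lambda>N. (b - a) * ln (q_number q (real N)) + (\<Sum>k<N. ?S b k - ?S a k))
      \<longlonglongrightarrow> (b - a) * (- ln (1 - q)) + (suminf (?S b) - suminf (?S a))"
    unfolding sum_subtractf[of "?S b" "?S a"]
    using ln_q_number_tendsto[OF q, of 0]
    by (intro tendsto_intros summable_LIMSEQ q_Gamma_series(1)[OF q] a b) auto
  also have "(b - a) * (- ln (1 - q)) + (suminf (?S b) - suminf (?S a)) = ln (q_Gamma q b / q_Gamma q a)"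
    using q_Gamma_pos[of q a] q_Gamma_pos[of q b] q a b
    by (simp add: ln_div q_Gamma_eq_exp algebra_simps)
  finally show ?thesis unfolding term_eq .
qed

text \<open>Keeps the final inequalities strict: a limit preserves only \<le>, but the fixed
  positive gap \<open>d 0\<close> survives it.\<close>

lemma first_le_sum:
  fixes d :: "nat \<Rightarrow> real"
  assumes "\<And>k. 0 < d k" "1 \<le> N"
  shows "d 0 \<le> (\<Sum>k<N. d k)"
  using assms sum_mono2[of "{..<N}" "{0}" d] by (auto intro: less_imp_le)

section \<open>Summation of the estimates and passage to the limit\<close>

theorem theorem3p3:
  fixes q s :: real
  assumes "0 < q" and "q \<le> 1" and "0 < s" and "s < 1"
  shows "(\<forall>x::real. x > - s / 2 \<longrightarrow>
            q_number q (x + s / 2) powr (1 - s) < q_Gamma q (x + 1) / q_Gamma q (x + s)) \<and>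
         (\<forall>x::real. x > - s \<longrightarrow>
            q_Gamma q (x + 1) / q_Gamma q (x + s) < exp ((1 - s) * q_psi q (x + (s + 1) / 2)))"
proof (intro conjI allI impI)
  define G where "G u = ln (q_number q u)" for u
  define A where "A x N = (1 - s) * G (real N)
            + (\<Sum>k<N. G (real k + (x + s)) - G (real k + (x + 1)))" for x and N :: nat
  have lim: "A x \<longlonglongrightarrow> ln (q_Gamma q (x + 1) / q_Gamma q (x + s))" if "x > - s" for x
    using q_Gamma_ratio_LIMSEQ[of q "x + s" "x + 1"] assms that unfolding A_def G_def by simp
  have pos: "0 < q_Gamma q (x + 1) / q_Gamma q (x + s)" if "x > - s" for x
    using q_Gamma_pos[of q "x + 1"] q_Gamma_pos[of q "x + s"] assms that by simp
  {
    fix x :: real assume x: "x > - s / 2"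
    then have xs: "x > - s" using assms by simp
    \<comment> \<open>The gap in the chord estimate about the midpoint of k + x + s and k + x + 1,
      with t = (1 - s)/2. The choice T = 1/2 makes the chord endpoints for successive k meet, so
      that the last bracket telescopes.\<close>
    define d where "d k = G (real k + (x + s)) - G (real k + (x + 1))
       + (1 - s) * (G (real (Suc k) + (x + s / 2)) - G (real k + (x + s / 2)))" for k
    have d: "0 < d k" for k
    proof -
      have "G (real k + (x + 1)) - G (real k + (x + s))
          < (1 - s) * (G (real (Suc k) + (x + s / 2)) - G (real k + (x + s / 2)))"
      proof -
        define m where "m = real k + x + (s + 1) / 2"
        have e: "m + (1 - s) / 2 = real k + (x + 1)" "m - (1 - s) / 2 = real k + (x + s)"
          "m + 1 / 2 = real (Suc k) + (x + s / 2)" "m - 1 / 2 = real k + (x + s / 2)"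
          "(1 - s) / 2 / (1 / 2) = 1 - s"
          by (simp_all add: m_def field_simps)
        \<comment> \<open>\<open>1 / 2 < m\<close> says k + x + s/2 > 0; at k = 0 this is exactly
          the hypothesis on x.\<close>
        have "(1 - s) / 2 < m" "1 / 2 < m" using x assms by (simp_all add: m_def field_simps)
        then show ?thesis
          using ln_q_number_chord(2)[of q "(1 - s) / 2" m "1 / 2"] assms unfolding G_def e by simp
      qed
      then show ?thesis by (simp add: d_def)
    qed
    \<comment> \<open>The near end of the telescoping sum is the desired bound
      \<open>G (x + s / 2)\<close>; the far end, compared with \<open>G (real N)\<close>, disappears
      in the limit.\<close>
    have A: "A x N = (\<Sum>k<N. d k) - (1 - s) * (G (real N + (x + s / 2)) - G (real N))
        + (1 - s) * G (x + s / 2)" for N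
      unfolding A_def d_def sum.distrib sum_distrib_left[symmetric]
        sum_lessThan_telescope[of "\<lambda>k. G (real k + (x + s / 2))"]
      by (simp add: algebra_simps)
    have "(\<lambda>N. A x N + (1 - s) * (G (real N + (x + s / 2)) - G (real N)))
        \<longlonglongrightarrow> ln (q_Gamma q (x + 1) / q_Gamma q (x + s)) + (1 - s) * 0"
      unfolding G_def using x assms
      by (intro tendsto_intros lim ln_q_number_shift_tendsto) auto
    moreover have "eventually (\<lambda>N. d 0 + (1 - s) * G (x + s / 2)
        \<le> A x N + (1 - s) * (G (real N + (x + s / 2)) - G (real N))) sequentially"
      using eventually_ge_at_top[of 1]
      by eventually_elim (use first_le_sum[of d] d in \<open>simp add: A\<close>)
    ultimately have "d 0 + (1 - s) * G (x + s / 2) \<le> ln (q_Gamma q (x + 1) / q_Gamma q (x + s))"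
      by (simp add: tendsto_lowerbound)
    then have "(1 - s) * G (x + s / 2) < ln (q_Gamma q (x + 1) / q_Gamma q (x + s))"
      using d[of 0] by simp
    then have "exp ((1 - s) * G (x + s / 2)) < q_Gamma q (x + 1) / q_Gamma q (x + s)"
      using pos[OF xs] by (metis exp_less_cancel_iff exp_ln)
    moreover have "0 < q_number q (x + s / 2)" using assms x by (intro q_number_pos) auto
    ultimately show "q_number q (x + s / 2) powr (1 - s) < q_Gamma q (x + 1) / q_Gamma q (x + s)"
      by (simp add: powr_def G_def)
  next
    fix x :: real assume x: "x > - s"
    define m where "m = x + (s + 1) / 2"
    \<comment> \<open>The gap in the tangent estimate at the same midpoints. It only requires k + x
      + s > 0, whence the wider range of x.\<close>
    define e where "e k = G (real k + (x + 1)) - G (real k + (x + s))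
       - (1 - s) * q_slope q (real k + m)" for k
    have e: "0 < e k" for k
    proof -
      have e': "real k + m + (1 - s) / 2 = real k + (x + 1)" "real k + m - (1 - s) / 2 = real k + (x + s)"
        "2 * ((1 - s) / 2) = 1 - s"
        by (simp_all add: m_def field_simps)
      have "(1 - s) / 2 < real k + m" using x by (simp add: m_def field_simps)
      then show ?thesis
        using ln_q_number_chord(1)[of q "(1 - s) / 2" "real k + m"] assms
        unfolding e_def G_def e' by simp
    qed
    have A: "A x N = (1 - s) * (G (real N) - (\<Sum>k<N. q_slope q (real k + m))) - (\<Sum>k<N. e k)" for N
      unfolding A_def e_def sum_subtractf sum_distrib_left[symmetric] by (simp add: algebra_simps)
    have "(\<lambda>N. (1 - s) * (G (real N) - (\<Sum>k<N. q_slope q (real k + m))) - A x N)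
        \<longlonglongrightarrow> (1 - s) * q_psi q m - ln (q_Gamma q (x + 1) / q_Gamma q (x + s))"
      unfolding G_def using x assms
      by (intro tendsto_intros lim q_psi_LIMSEQ) (auto simp: m_def field_simps)
    moreover have "eventually (\<lambda>N. e 0
        \<le> (1 - s) * (G (real N) - (\<Sum>k<N. q_slope q (real k + m))) - A x N) sequentially"
      using eventually_ge_at_top[of 1]
      by eventually_elim (use first_le_sum[of e] e in \<open>simp add: A\<close>)
    ultimately have "e 0 \<le> (1 - s) * q_psi q m - ln (q_Gamma q (x + 1) / q_Gamma q (x + s))"
      by (simp add: tendsto_lowerbound)
    then have "ln (q_Gamma q (x + 1) / q_Gamma q (x + s)) < (1 - s) * q_psi q m"
      using e[of 0] by simp
    then show "q_Gamma q (x + 1) / q_Gamma q (x + s) < exp ((1 - s) * q_psi q (x + (s + 1) / 2))"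
      using pos[OF x] by (metis exp_less_cancel_iff exp_ln m_def)
  }
qed

end
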